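(* Let $\leq$ be a monomial order on $\mathfrak{M}(X)$ and let $S\subseteq\mathbf{k}\mathfrak{M}(X)$ be monic with respect to $\leq$. Put $\mathrm{Irr}(S)=\mathfrak{M}(X)\setminus\{q|_{\overline{s}}\mid s\in S,\ q\in\mathfrak{M}^\star(X)\}$. Then the following are equivalent: (a) $\Pi_S$ is convergent; (b) $\Pi_S$ is confluent; (c) $\mathrm{Id}(S)\cap\mathbf{k}\,\mathrm{Irr}(S)=0$; (d) $\mathrm{Id}(S)\oplus\mathbf{k}\,\mathrm{Irr}(S)=\mathbf{k}\mathfrak{M}(X)$; (e) $S$ is a Gröbner-Shirshov basis in $\mathbf{k}\mathfrak{M}(X)$.
   Context: $\mathbf{k}$ is a fixed (commutative, unital) domain, $\mathbf{k}^\times=\mathbf{k}\setminus\{0\}$, $X$ is a non-empty set, and $\mathbf{k}Y$ denotes the $\mathbf{k}$-span of $Y$. Bracketed words: for a set $Y$, $M(Y)$ is the free monoid on $Y$ with identity $1$ and $\lfloor Y\rfloor=\{\lfloor y\rfloor\mid y\in Y\}$ is a disjoint copy of $Y$. Put $\mathfrak{M}_0(X)=M(X)$, $\mathfrak{M}_n(X)=M(X\sqcup\lfloor\mathfrak{M}_{n-1}(X)\rfloor)$ for $n\ge1$, with the natural inclusions $\mathfrak{M}_{n-1}(X)\hookrightarrow\mathfrak{M}_n(X)$, and $\mathfrak{M}(X)=\bigcup_n\mathfrak{M}_n(X)$ (bracketed words), a monoid with the operator $u\mapsto\lfloor u\rfloor$. $\mathbf{k}\mathfrak{M}(X)$ is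 the free $\mathbf{k}$-module on $\mathfrak{M}(X)$, with product and operator $\lfloor\ \rfloor$ extended linearly. Each $u\neq1$ is uniquely $u=u_1\cdots u_n$ with $u_i\in X\sqcup\lfloor\mathfrak{M}(X)\rfloor$; its breadth is $|u|=n$, and $|1|=0$. $\mathrm{Id}(S)$ is the smallest operated ideal (two-sided ideal closed under $\lfloor\ \rfloor$) containing $S$. $\mathfrak{M}^\star(X)$ is the set of bracketed words on $X\sqcup\{\star\}$ with exactly one occurrence of $\star$; for $q\in\mathfrak{M}^\star(X)$ and $u\in\mathfrak{M}(X)$, $q|_u$ is obtained by replacing $\star$ by $u$, and $q|_s=\sum_i c_iq|_{u_i}$ for $s=\sum_i c_iu_i\in\mathbf{k}\mathfrak{M}(X)$. A monomial order on $\mathfrak{M}(X)$ is a well-order $\leq$ such that $u<v$ implies $q|_u<q|_v$ for all $q\in\mathfrak{M}^\star(X)$. For $s\in\mathbf{k}\mathfrak{M}(X)\setminus\mathbf{k}$, $\overline{s}$ is the largest monomial appearing in $s$. $s$ is monic if $s\notin\mathbf{k}$ and the coefficient of $\overline{s}$ in $s$ is $1$; $S$ is monic if all its elements are. For monic $s$, $R(s):=\overline{s}-s$. Rewriting: $\Pi_S=\{q|_{\overline{s}}\to q|_{R(s)}\mid s\in S,\ q\in\mathfrak{M}^\star(X)\}\subseteq\mathfrak{M}(X)\times\mathbf{k}\mathfrak{M}(X)$. One step $f\to g$ means: some rule $t\to v$ in $\Pi_S$ has $t$ occurring in $f$ with coefficient $c\neq0$ and $g=f-ct+cv$. $\overset{*}{\to}$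 is the reflexive-transitive closure. $\Pi_S$ is terminating if there is no infinite chain $f_0\to f_1\to\cdots$; confluent if whenever $f\overset{*}{\to}g$ and $f\overset{*}{\to}h$ there is $e$ with $g\overset{*}{\to}e$ and $h\overset{*}{\to}e$; convergent if terminating and confluent. Gröbner-Shirshov basis: let $f,g\in\mathbf{k}\mathfrak{M}(X)$ be monic. If $\mu,\nu,w\in\mathfrak{M}(X)$ satisfy $w=\overline{f}\mu=\nu\overline{g}$ with $\max\{|\overline{f}|,|\overline{g}|\}<|w|<|\overline{f}|+|\overline{g}|$, then $f\mu-\nu g$ is an intersection composition of $f,g$ with respect to $w$. If $q\in\mathfrak{M}^\star(X)$ and $w=\overline{f}=q|_{\overline{g}}$, then $f-q|_g$ is an including composition of $f,g$ with respect to $w$. An element $h$ is trivial modulo $(S,w)$ if $h=\sum_i c_iq_i|_{s_i}$ (finite sum) with $c_i\in\mathbf{k}$, $q_i\in\mathfrak{M}^\star(X)$, $s_i\in S$ and $q_i|_{\overline{s_i}}<w$ for all $i$. A monic $S$ is a Gröbner-Shirshov basis if for all $f,g\in S$ every intersection composition and every including composition of $f,g$ with respect to $w$ is trivial modulo $(S,w)$. *)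

theory Defs
  imports Complex_Main "HOL-Library.Poly_Mapping" "HOL-Library.Confluence"
begin

section \<open>Bracketed words\<close>

text \<open>
  A bracketed word is a list of letters taken from \<open>X\<close> or from the bracketed copy of the
  bracketed words themselves; the datatype is the union of the filtration by bracket depth.
  The (non-empty) set \<open>X\<close> is the type \<open>'x\<close>. The breadth of a word is its \<open>length\<close>.
\<close>

datatype 'x bletter = Var 'x | Brk "'x bletter list"

type_synonym 'x bword = "'x bletter list"

text \<open>
  Concatenation makes lists a monoid. It is registered in additive notation because
  \<open>Poly_Mapping\<close> takes additive exponents; thereby \<open>'x bword \<Rightarrow>\<^sub>0 'k\<close> is the
  (noncommutative) monoid algebra, with \<open>single [] 1\<close> as its unit.
\<close>

instantiation list :: (type) monoid_add
begin

definition zero_list :: "'a list" where "zero_list = []"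

definition plus_list :: "'a list \<Rightarrow> 'a list \<Rightarrow> 'a list" where "plus_list u v = u @ v"

instance by standard (simp_all add: zero_list_def plus_list_def)

end

type_synonym ('x, 'k) bpoly = "'x bword \<Rightarrow>\<^sub>0 'k"

definition mono_of :: "'x bword \<Rightarrow> ('x, 'k::idom) bpoly"
  where "mono_of u = Poly_Mapping.single u 1"

definition smul :: "'k::idom \<Rightarrow> ('x, 'k) bpoly \<Rightarrow> ('x, 'k) bpoly"
  where "smul c f = Poly_Mapping.map ((*) c) f"

lemma lookup_smul: "Poly_Mapping.lookup (smul c f) u = c * Poly_Mapping.lookup f u"
  by (simp add: smul_def Poly_Mapping.map.rep_eq when_def)

lemma module_smul: "module (smul :: 'k::idom \<Rightarrow> ('x, 'k) bpoly \<Rightarrow> ('x, 'k) bpoly)"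
  by (rule module.intro; rule poly_mapping_eqI) (simp_all add: lookup_smul lookup_add algebra_simps)

definition kspan :: "'x bword set \<Rightarrow> ('x, 'k::idom) bpoly set"
  where "kspan Y = module.span smul (mono_of ` Y)"

definition linext :: "('y bword \<Rightarrow> 'x bword) \<Rightarrow> ('y, 'k::idom) bpoly \<Rightarrow> ('x, 'k) bpoly"
  where "linext \<phi> f =
    (\<Sum>u\<in>Poly_Mapping.keys f. smul (Poly_Mapping.lookup f u) (mono_of (\<phi> u)))"

definition bracket :: "('x, 'k::idom) bpoly \<Rightarrow> ('x, 'k) bpoly"
  where "bracket = linext (\<lambda>u. [Brk u])"

section \<open>Operated ideals\<close>

text \<open>
  Closure under scalars and negation follows from closure under multiplication, the scalars
  being the multiples of the unit.
\<close>

definition operated_ideal :: "('x, 'k::idom) bpoly set \<Rightarrow> bool"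
  where "operated_ideal I \<longleftrightarrow>
    0 \<in> I \<and> (\<forall>f\<in>I. \<forall>g\<in>I. f + g \<in> I) \<and>
    (\<forall>f\<in>I. \<forall>g. g * f \<in> I \<and> f * g \<in> I) \<and> (\<forall>f\<in>I. bracket f \<in> I)"

definition operated_Id :: "('x, 'k::idom) bpoly set \<Rightarrow> ('x, 'k) bpoly set"
  where "operated_Id S = \<Inter> {I. operated_ideal I \<and> S \<subseteq> I}"

section \<open>Star words\<close>

text \<open>
  Words over \<open>X\<close> with an additional letter \<open>\<star>\<close> are words over \<open>'x option\<close>, with \<open>None\<close> as \<open>\<star>\<close>.
\<close>

primrec stars_letter :: "'x option bletter \<Rightarrow> nat"
  where
    "stars_letter (Var y) = (if y = None then 1 else 0)"
  | "stars_letter (Brk w) = sum_list (map stars_letter w)"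

definition star_words :: "'x option bword set"
  where "star_words = {q. sum_list (map stars_letter q) = 1}"

primrec plug_letter :: "'x bword \<Rightarrow> 'x option bletter \<Rightarrow> 'x bword"
  where
    "plug_letter u (Var y) = (case y of None \<Rightarrow> u | Some x \<Rightarrow> [Var x])"
  | "plug_letter u (Brk w) = [Brk (concat (map (plug_letter u) w))]"

definition plug :: "'x option bword \<Rightarrow> 'x bword \<Rightarrow> 'x bword"
  where "plug q u = concat (map (plug_letter u) q)"

definition plug_poly :: "'x option bword \<Rightarrow> ('x, 'k::idom) bpoly \<Rightarrow> ('x, 'k) bpoly"
  where "plug_poly q = linext (plug q)"

section \<open>Monomial orders and leading monomials\<close>

text \<open>Orders are represented by their reflexive relation, as in \<open>well_order_on\<close>.\<close>

definition strict_less :: "'a rel \<Rightarrow> 'a \<Rightarrow> 'a \<Rightarrow> bool"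
  where "strict_less r u v \<longleftrightarrow> (u, v) \<in> r \<and> u \<noteq> v"

definition monomial_order :: "'x bword rel \<Rightarrow> bool"
  where "monomial_order r \<longleftrightarrow> well_order_on UNIV r \<and>
    (\<forall>u v. \<forall>q\<in>star_words. strict_less r u v \<longrightarrow> strict_less r (plug q u) (plug q v))"

definition constants :: "('x, 'k::idom) bpoly set"
  where "constants = range (\<lambda>c. smul c 1)"

text \<open>Only meaningful for non-zero \<open>s\<close>; it is used for monic \<open>s\<close>, which are not constant.\<close>

definition lead_mon :: "'x bword rel \<Rightarrow> ('x, 'k::idom) bpoly \<Rightarrow> 'x bword"
  where "lead_mon r s =
    (THE u. u \<in> Poly_Mapping.keys s \<and> (\<forall>v\<in>Poly_Mapping.keys s. (v, u) \<in> r))"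

definition monic_poly :: "'x bword rel \<Rightarrow> ('x, 'k::idom) bpoly \<Rightarrow> bool"
  where "monic_poly r s \<longleftrightarrow> s \<notin> constants \<and> Poly_Mapping.lookup s (lead_mon r s) = 1"

definition monic_set :: "'x bword rel \<Rightarrow> ('x, 'k::idom) bpoly set \<Rightarrow> bool"
  where "monic_set r S \<longleftrightarrow> (\<forall>s\<in>S. monic_poly r s)"

definition remainder :: "'x bword rel \<Rightarrow> ('x, 'k::idom) bpoly \<Rightarrow> ('x, 'k) bpoly"
  where "remainder r s = mono_of (lead_mon r s) - s"

definition Irr :: "'x bword rel \<Rightarrow> ('x, 'k::idom) bpoly set \<Rightarrow> 'x bword set"
  where "Irr r S = UNIV - {plug q (lead_mon r s) | s q. s \<in> S \<and> q \<in> star_words}"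

section \<open>Rewriting\<close>

definition rewrite_rules ::
    "'x bword rel \<Rightarrow> ('x, 'k::idom) bpoly set \<Rightarrow> ('x bword \<times> ('x, 'k) bpoly) set"
  where "rewrite_rules r S =
    {(plug q (lead_mon r s), plug_poly q (remainder r s)) | s q. s \<in> S \<and> q \<in> star_words}"

definition rewrite_step ::
    "('x bword \<times> ('x, 'k::idom) bpoly) set \<Rightarrow> ('x, 'k) bpoly \<Rightarrow> ('x, 'k) bpoly \<Rightarrow> bool"
  where "rewrite_step P f g \<longleftrightarrow> (\<exists>t v c. (t, v) \<in> P \<and>
    c = Poly_Mapping.lookup f t \<and> c \<noteq> 0 \<and> g = f - smul c (mono_of t) + smul c v)"

definition terminating :: "('x bword \<times> ('x, 'k::idom) bpoly) set \<Rightarrow> bool"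
  where "terminating P \<longleftrightarrow> \<not> (\<exists>f. \<forall>i::nat. rewrite_step P (f i) (f (Suc i)))"

definition confluent :: "('x bword \<times> ('x, 'k::idom) bpoly) set \<Rightarrow> bool"
  where "confluent P \<longleftrightarrow> confluentp (rewrite_step P)"

definition convergent_rules :: "('x bword \<times> ('x, 'k::idom) bpoly) set \<Rightarrow> bool"
  where "convergent_rules P \<longleftrightarrow> terminating P \<and> confluent P"

section \<open>Groebner-Shirshov bases\<close>

definition intersection_composition ::
    "'x bword rel \<Rightarrow> ('x, 'k::idom) bpoly \<Rightarrow> ('x, 'k) bpoly \<Rightarrow> 'x bword \<Rightarrow> ('x, 'k) bpoly \<Rightarrow> bool"
  where "intersection_composition r f g w h \<longleftrightarrow> (\<exists>\<mu> \<nu>.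
    w = lead_mon r f @ \<mu> \<and> w = \<nu> @ lead_mon r g \<and>
    max (length (lead_mon r f)) (length (lead_mon r g)) < length w \<and>
    length w < length (lead_mon r f) + length (lead_mon r g) \<and>
    h = f * mono_of \<mu> - mono_of \<nu> * g)"

definition including_composition ::
    "'x bword rel \<Rightarrow> ('x, 'k::idom) bpoly \<Rightarrow> ('x, 'k) bpoly \<Rightarrow> 'x bword \<Rightarrow> ('x, 'k) bpoly \<Rightarrow> bool"
  where "including_composition r f g w h \<longleftrightarrow> (\<exists>q\<in>star_words.
    w = lead_mon r f \<and> w = plug q (lead_mon r g) \<and> h = f - plug_poly q g)"

definition trivial_mod ::
    "'x bword rel \<Rightarrow> ('x, 'k::idom) bpoly set \<Rightarrow> 'x bword \<Rightarrow> ('x, 'k) bpoly \<Rightarrow> bool"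
  where "trivial_mod r S w h \<longleftrightarrow> (\<exists>(n::nat) c q s.
    h = (\<Sum>i<n. smul (c i) (plug_poly (q i) (s i))) \<and>
    (\<forall>i<n. q i \<in> star_words \<and> s i \<in> S \<and> strict_less r (plug (q i) (lead_mon r (s i))) w))"

definition groebner_shirshov_basis :: "'x bword rel \<Rightarrow> ('x, 'k::idom) bpoly set \<Rightarrow> bool"
  where "groebner_shirshov_basis r S \<longleftrightarrow> monic_set r S \<and>
    (\<forall>f\<in>S. \<forall>g\<in>S. \<forall>w h.
      intersection_composition r f g w h \<or> including_composition r f g w h
        \<longrightarrow> trivial_mod r S w h)"

section \<open>Internal direct sums\<close>

definition direct_sum_whole :: "('x, 'k::idom) bpoly set \<Rightarrow> ('x, 'k) bpoly set \<Rightarrow> bool"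
  where "direct_sum_whole U V \<longleftrightarrow> U \<inter> V = {0} \<and> {u + v | u v. u \<in> U \<and> v \<in> V} = UNIV"

end

theory Submission
  imports Defs "HOL-Library.Multiset"
begin

text \<open>
  A star word matters only through the substitution \<open>u \<mapsto> q|\<^sub>u\<close> that it induces. These maps, here
  called contexts, are injective, strictly monotone, closed under composition, and generated by two
  shapes: a hole between two words, and a bracket around a context between two words. Everything
  below is phrased with contexts \<open>\<phi>\<close> and the polynomials \<open>\<phi>(s)\<close> (linear extension), whose leading
  monomial is \<open>\<phi>\<close> of the leading monomial of \<open>s\<close>, with coefficient \<open>1\<close>.

  For a set \<open>W\<close> of words let \<open>J(W)\<close> (\<open>ideal_within\<close>) be the span of those \<open>\<phi>(s)\<close> whose leading
  monomial lies in \<open>W\<close>. Then \<open>J\<close> of all words is the operated ideal generated by \<open>S\<close>, and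
  \<open>J\<close> of the words below \<open>w\<close> consists of the elements that are trivial modulo \<open>(S, w)\<close>. A rewriting
  step replaces \<open>f\<close> by \<open>f - c \<phi>(s)\<close>, where \<open>c\<close> is the coefficient in \<open>f\<close> of the leading monomial of
  \<open>\<phi>(s)\<close>. It exchanges one monomial for smaller ones, so rewriting always terminates
  (\<open>wf_step\<close>). Hence convergence is the same as confluence, and the ideal together with the
  irreducible words always spans everything, so that the direct sum decomposition amounts to the
  trivial intersection \<open>irr_independent\<close>.

  The remaining conditions are compared with this trivial intersection. If rewriting is
  confluent, then \<open>f\<close> and \<open>f + c \<phi>(s)\<close> are joinable, so every element of the ideal rewrites to \<open>0\<close>,
  while a combination of irreducible words cannot be rewritten at all. Conversely, two normal forms
  of the same \<open>f\<close> differ by an element of the ideal that is supported on irreducible words. If the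
  intersection is trivial, a composition with respect to \<open>w\<close> lies in the ideal and has only monomials below \<open>w\<close>; its
  normal form is \<open>0\<close>, and the reduction exhibits it as trivial modulo \<open>(S, w)\<close>.

  That a Groebner-Shirshov basis has trivial intersection rests on the lemma \<open>resolvable\<close>: if \<open>\<phi>(s)\<close> and \<open>\<psi>(t)\<close> have the same leading
  monomial \<open>w\<close>, their difference lies in \<open>J\<close> of the words below \<open>w\<close>. It comes from the relative
  position of the two subwords of \<open>w\<close>: disjoint occurrences are handled by bilinearity, nested ones by
  including compositions, overlapping ones by intersection compositions. It
  follows that an element of the ideal with bound \<open>w\<close> is a multiple of a single \<open>\<phi>(s)\<close> with leading
  monomial \<open>w\<close>, modulo smaller terms. If it is supported on irreducible words the
  multiple must be \<open>0\<close>, the bound drops, and well-founded induction shows that the element is \<open>0\<close>.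
\<close>

section \<open>Linear extensions\<close>

interpretation bp: module "smul :: 'k::idom \<Rightarrow> ('x, 'k) bpoly \<Rightarrow> ('x, 'k) bpoly"
  by (rule module_smul)

lemma smul_single: "smul c (Poly_Mapping.single u d) = Poly_Mapping.single u (c * d)"
  by (rule poly_mapping_eqI) (simp add: lookup_smul lookup_single when_def)

lemma lookup_mono_of: "Poly_Mapping.lookup (mono_of u :: ('x, 'k::idom) bpoly) v = (if u = v then 1 else 0)"
  by (simp add: mono_of_def lookup_single when_def)

lemma linext_eq_sum:
  assumes "finite A" "Poly_Mapping.keys f \<subseteq> A"
  shows "linext \<phi> f = (\<Sum>u\<in>A. smul (Poly_Mapping.lookup f u) (mono_of (\<phi> u)))"
  unfolding linext_def
  by (rule sum.mono_neutral_left) (use assms in \<open>auto simp: in_keys_iff\<close>)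

lemma linext_eq_sum_single:
  "linext \<phi> f = (\<Sum>u\<in>Poly_Mapping.keys f. Poly_Mapping.single (\<phi> u) (Poly_Mapping.lookup f u))"
  by (simp add: linext_def mono_of_def smul_single)

lemma linext_add: "linext \<phi> (f + g) = linext \<phi> f + linext \<phi> g"
  and linext_diff: "linext \<phi> (f - g) = linext \<phi> f - linext \<phi> g"
proof -
  let ?A = "Poly_Mapping.keys f \<union> Poly_Mapping.keys g"
  have A: "finite ?A" "Poly_Mapping.keys f \<subseteq> ?A" "Poly_Mapping.keys g \<subseteq> ?A" by auto
  note * = linext_eq_sum[OF A(1,2)] linext_eq_sum[OF A(1,3)]
  show "linext \<phi> (f + g) = linext \<phi> f + linext \<phi> g"
    by (subst linext_eq_sum[OF A(1) keys_add])
      (simp add: * lookup_add bp.scale_left_distrib sum.distrib)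
  show "linext \<phi> (f - g) = linext \<phi> f - linext \<phi> g"
    by (subst linext_eq_sum[OF A(1) keys_diff])
      (simp add: * lookup_minus bp.scale_left_diff_distrib sum_subtractf)
qed

lemma linext_smul: "linext \<phi> (smul c f) = smul c (linext \<phi> f)"
proof -
  have "Poly_Mapping.keys (smul c f) \<subseteq> Poly_Mapping.keys f"
    by (auto simp: in_keys_iff lookup_smul)
  then have "linext \<phi> (smul c f) =
      (\<Sum>u\<in>Poly_Mapping.keys f. smul (Poly_Mapping.lookup (smul c f) u) (mono_of (\<phi> u)))"
    by (intro linext_eq_sum) auto
  then show ?thesis by (simp add: linext_def lookup_smul bp.scale_sum_right)
qed

lemma linext_0: "linext \<phi> 0 = 0"
  by (simp add: linext_def)

lemma linext_sum: "linext \<phi> (\<Sum>i\<in>I. F i) = (\<Sum>i\<in>I. linext \<phi> (F i))"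
  by (induction I rule: infinite_finite_induct) (auto simp: linext_0 linext_add)

lemma linext_mono_of: "linext \<phi> (mono_of u :: ('y, 'k::idom) bpoly) = mono_of (\<phi> u)"
proof -
  have "linext \<phi> (mono_of u :: ('y, 'k::idom) bpoly) =
      (\<Sum>v\<in>{u}. smul (Poly_Mapping.lookup (mono_of u :: ('y, 'k) bpoly) v) (mono_of (\<phi> v)))"
    by (rule linext_eq_sum) (auto simp: mono_of_def)
  then show ?thesis by (simp add: lookup_mono_of)
qed

lemma poly_expansion:
  "f = (\<Sum>u\<in>Poly_Mapping.keys f. smul (Poly_Mapping.lookup f u) (mono_of u))"
  by (rule poly_mapping_eqI)
    (simp add: lookup_sum lookup_smul lookup_mono_of in_keys_iff if_distrib sum.delta cong: if_cong)

lemma linext_ident: "linext (\<lambda>u. u) f = f"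
  using poly_expansion[of f] by (simp add: linext_def)

lemma linext_linext: "linext \<phi> (linext \<psi> f) = linext (\<lambda>u. \<phi> (\<psi> u)) f"
  unfolding linext_def[of \<psi>] by (simp add: linext_sum linext_smul linext_mono_of) (simp add: linext_def)

lemma keys_linext: "Poly_Mapping.keys (linext \<phi> f) \<subseteq> \<phi> ` Poly_Mapping.keys f"
proof
  fix v assume "v \<in> Poly_Mapping.keys (linext \<phi> f)"
  then have "(\<Sum>u\<in>Poly_Mapping.keys f. Poly_Mapping.lookup f u * (if \<phi> u = v then 1 else 0)) \<noteq> 0"
    by (simp add: in_keys_iff linext_def lookup_sum lookup_smul lookup_mono_of)
  then obtain u where "u \<in> Poly_Mapping.keys f" "\<phi> u = v"
    by (auto elim!: sum.not_neutral_contains_not_neutral split: if_splits)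
  then show "v \<in> \<phi> ` Poly_Mapping.keys f" by blast
qed

lemma lookup_linext_inj:
  assumes "inj \<phi>"
  shows "Poly_Mapping.lookup (linext \<phi> f) (\<phi> u) = Poly_Mapping.lookup f u"
  by (simp add: linext_def lookup_sum lookup_smul lookup_mono_of inj_eq[OF assms] in_keys_iff
      if_distrib sum.delta cong: if_cong)

lemma sum_singles:
  fixes f :: "('x, 'k::idom) bpoly"
  shows "(\<Sum>v\<in>Poly_Mapping.keys f. Poly_Mapping.single v (Poly_Mapping.lookup f v)) = f"
  using linext_ident[of f] by (simp add: linext_eq_sum_single)

lemma single_mult_eq_linext:
  "Poly_Mapping.single a c * f = smul c (linext (\<lambda>u. a @ u) f)"
proof -
  have "Poly_Mapping.single a c * f =
      Poly_Mapping.single a c * (\<Sum>v\<in>Poly_Mapping.keys f. Poly_Mapping.single v (Poly_Mapping.lookup f v))"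
    by (simp add: sum_singles)
  also have "\<dots> = smul c (linext (\<lambda>u. a @ u) f)"
    by (simp add: sum_distrib_left mult_single linext_eq_sum_single bp.scale_sum_right smul_single
        plus_list_def)
  finally show ?thesis .
qed

lemma mult_single_eq_linext:
  "f * Poly_Mapping.single a c = smul c (linext (\<lambda>u. u @ a) f)"
proof -
  have "f * Poly_Mapping.single a c =
      (\<Sum>v\<in>Poly_Mapping.keys f. Poly_Mapping.single v (Poly_Mapping.lookup f v)) * Poly_Mapping.single a c"
    by (simp add: sum_singles)
  also have "\<dots> = smul c (linext (\<lambda>u. u @ a) f)"
    by (simp add: sum_distrib_right mult_single linext_eq_sum_single bp.scale_sum_right smul_single
        plus_list_def mult.commute)
  finally show ?thesis .
qed

text \<open>
  Reduces closure under multiplication by arbitrary polynomials to closure under linear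
  extensions of the contexts \<open>u \<mapsto> a u\<close> and \<open>u \<mapsto> u a\<close>.
\<close>

lemma mult_eq_sum_linext:
  shows "g * f = (\<Sum>a\<in>Poly_Mapping.keys g. smul (Poly_Mapping.lookup g a) (linext (\<lambda>u. a @ u) f))"
    and "f * g = (\<Sum>a\<in>Poly_Mapping.keys g. smul (Poly_Mapping.lookup g a) (linext (\<lambda>u. u @ a) f))"
  using arg_cong[OF sum_singles[of g], of "\<lambda>h. h * f"] arg_cong[OF sum_singles[of g], of "\<lambda>h. f * h"]
  by (simp_all add: sum_distrib_left sum_distrib_right single_mult_eq_linext mult_single_eq_linext)

lemma kspan_eq:
  fixes Y :: "'x bword set"
  shows "kspan Y = {f :: ('x, 'k::idom) bpoly. Poly_Mapping.keys f \<subseteq> Y}"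
proof (rule set_eqI, rule iffI)
  fix f :: "('x, 'k) bpoly" assume "f \<in> kspan Y"
  then have "f \<in> bp.span (mono_of ` Y)" by (simp add: kspan_def)
  then have "Poly_Mapping.keys f \<subseteq> Y"
  proof (induction rule: bp.span_induct_alt)
    case (step c x y)
    then show ?case
      by (force simp: in_keys_iff lookup_add lookup_smul lookup_mono_of split: if_splits)
  qed simp
  then show "f \<in> {f. Poly_Mapping.keys f \<subseteq> Y}" by simp
next
  fix f :: "('x, 'k) bpoly" assume "f \<in> {f. Poly_Mapping.keys f \<subseteq> Y}"
  then have "(\<Sum>u\<in>Poly_Mapping.keys f. smul (Poly_Mapping.lookup f u) (mono_of u)) \<in> kspan Y"
    unfolding kspan_def by (intro bp.span_sum bp.span_scale bp.span_base) auto
  then show "f \<in> kspan Y" by (simp flip: poly_expansion)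
qed

section \<open>Contexts\<close>

text \<open>
  The outer words \<open>A\<close> and \<open>B\<close> are part of both constructors, so that each rule fixes the position
  of the star at the current bracket level. This is what the comparison of two occurrences in
  one word needs.
\<close>

inductive_set contexts :: "('x bword \<Rightarrow> 'x bword) set" where
  hole: "(\<lambda>u. A @ u @ B) \<in> contexts"
| brk: "\<phi> \<in> contexts \<Longrightarrow> (\<lambda>u. A @ [Brk (\<phi> u)] @ B) \<in> contexts"

lemma contexts_ident: "(\<lambda>u. u) \<in> contexts"
  using contexts.hole[of "[]" "[]"] by simp

lemma contexts_frame: "\<phi> \<in> contexts \<Longrightarrow> (\<lambda>u. A @ \<phi> u @ B) \<in> contexts"
proof (induction rule: contexts.cases)
  case (hole C D)
  then show ?case using contexts.hole[of "A @ C" "D @ B"] by simp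
next
  case (brk \<psi> C D)
  then show ?case using contexts.brk[of \<psi> "A @ C" "D @ B"] by simp
qed

lemma contexts_append_left: "(\<lambda>u. A @ u) \<in> contexts"
  using contexts.hole[of A "[]"] by simp

lemma contexts_append_right: "(\<lambda>u. u @ B) \<in> contexts"
  using contexts.hole[of "[]" B] by simp

lemma contexts_Brk: "(\<lambda>u. [Brk u]) \<in> contexts"
  using contexts.brk[OF contexts_ident, of "[]" "[]"] by simp

lemma contexts_comp: "\<phi> \<in> contexts \<Longrightarrow> \<psi> \<in> contexts \<Longrightarrow> (\<lambda>u. \<phi> (\<psi> u)) \<in> contexts"
  by (induction rule: contexts.induct) (use contexts.brk in \<open>auto intro: contexts_frame\<close>)

lemma plug_letter_map_bletter: "plug_letter u (map_bletter Some l) = [l]"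
proof (induction l)
  case (Brk w)
  have "concat (map (plug_letter u \<circ> map_bletter Some) w) = concat (map (\<lambda>l. [l]) w)"
    using Brk by (intro arg_cong[of _ _ concat] map_cong) auto
  then show ?case by simp
qed simp

lemma plug_map: "plug (map (map_bletter Some) A) u = A"
  by (induction A) (auto simp: plug_def plug_letter_map_bletter)

lemma stars_letter_map_bletter: "stars_letter (map_bletter Some l) = 0"
  by (induction l) auto

lemma stars_map: "sum_list (map stars_letter (map (map_bletter Some) A)) = 0"
  by (induction A) (auto simp: stars_letter_map_bletter)

lemma plug_append: "plug (a @ b) u = plug a u @ plug b u"
  by (simp add: plug_def)

lemma plug_Cons: "plug (l # b) u = plug_letter u l @ plug b u"
  by (simp add: plug_def)

lemma plug_letter_Brk: "plug_letter u (Brk w) = [Brk (plug w u)]"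
  by (simp add: plug_def)

lemma plug_letter_no_star: "stars_letter l = 0 \<Longrightarrow> plug_letter u l = plug_letter v l"
proof (induction l)
  case (Brk w)
  then show ?case by (auto intro!: arg_cong[of _ _ concat] map_cong)
qed (auto split: option.splits if_splits)

lemma plug_no_star: "sum_list (map stars_letter a) = 0 \<Longrightarrow> plug a u = plug a v"
  unfolding plug_def by (auto intro!: arg_cong[of _ _ concat] map_cong intro: plug_letter_no_star)

lemma sum_list_eq_1_split:
  fixes f :: "'a \<Rightarrow> nat"
  assumes "sum_list (map f w) = 1"
  obtains a l b where "w = a @ [l] @ b" "f l = 1" "sum_list (map f a) = 0" "sum_list (map f b) = 0"
proof -
  have "\<exists>a l b. w = a @ [l] @ b \<and> f l = 1 \<and> sum_list (map f a) = 0 \<and> sum_list (map f b) = 0"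
    using assms
  proof (induction w)
    case (Cons x w)
    show ?case
    proof (cases "f x = 0")
      case True
      with Cons obtain a l b where
        "w = a @ [l] @ b" "f l = 1" "sum_list (map f a) = 0" "sum_list (map f b) = 0" by auto
      then show ?thesis using True by (intro exI[of _ "x # a"] exI[of _ l] exI[of _ b]) auto
    next
      case False
      then have "x # w = [] @ [x] @ w \<and> f x = 1 \<and> sum_list (map f []) = 0 \<and> sum_list (map f w) = 0"
        using Cons.prems by (simp del: sum_list_eq_0_iff)
      then show ?thesis by blast
    qed
  qed simp
  then show ?thesis using that by blast
qed

text \<open>
  The unique star of a star word lies inside exactly one letter; the letters around it are
  unaffected by the substitution and become the constant words \<open>A\<close> and \<open>B\<close>.
\<close>

lemma plug_star_word:
  assumes "q \<in> star_words"
  obtains A l B where "l \<in> set q" "stars_letter l = 1" "plug q = (\<lambda>u. A @ plug_letter u l @ B)"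
proof -
  have "sum_list (map stars_letter q) = 1"
    using assms by (simp add: star_words_def)
  then obtain a l b where w: "q = a @ [l] @ b" "stars_letter l = 1"
    "sum_list (map stars_letter a) = 0" "sum_list (map stars_letter b) = 0"
    by (rule sum_list_eq_1_split)
  have "plug q u = plug a [] @ plug_letter u l @ plug b []" for u
    using plug_no_star[OF w(3), of u "[]"] plug_no_star[OF w(4), of u "[]"]
    by (simp add: w(1) plug_append) (simp add: plug_def)
  then show ?thesis using that[of l "plug a []" "plug b []"] w by auto
qed

lemma plug_letter_in_contexts: "stars_letter l = 1 \<Longrightarrow> (\<lambda>u. plug_letter u l) \<in> contexts"
proof (induction l)
  case (Var y)
  then show ?case by (cases y) (auto intro: contexts_ident)
next
  case (Brk w)
  then have "w \<in> star_words" by (simp add: star_words_def)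
  then obtain A l B where l: "l \<in> set w" "stars_letter l = 1"
    and w: "plug w = (\<lambda>u. A @ plug_letter u l @ B)"
    by (rule plug_star_word)
  have "plug w \<in> contexts"
    unfolding w using Brk.IH l by (intro contexts_frame) auto
  then have "(\<lambda>u. [Brk (plug w u)]) \<in> contexts"
    by (rule contexts_comp[OF contexts_Brk])
  then show ?case by (simp add: plug_def)
qed

lemma plug_in_contexts: "q \<in> star_words \<Longrightarrow> plug q \<in> contexts"
  by (erule plug_star_word) (simp add: contexts_frame[OF plug_letter_in_contexts])

text \<open>
  A word without stars is embedded into the words over \<open>'x option\<close> by mapping \<open>Some\<close> over its
  letters; surrounding the star by such words realises both constructors of contexts.
\<close>

lemma contexts_eq_plug: "contexts = plug ` star_words"
proof (intro equalityI subsetI)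
  fix \<phi> :: "'x bword \<Rightarrow> 'x bword" assume "\<phi> \<in> contexts"
  then show "\<phi> \<in> plug ` star_words"
  proof (induction rule: contexts.induct)
    case (hole A B)
    let ?q = "map (map_bletter Some) A @ [Var None] @ map (map_bletter Some) B"
    have "?q \<in> star_words" by (simp add: star_words_def stars_map del: map_map)
    moreover have "plug ?q = (\<lambda>u. A @ u @ B)"
      by (simp add: plug_append plug_Cons plug_map fun_eq_iff)
    ultimately show ?case by (metis imageI)
  next
    case (brk \<phi> A B)
    then obtain q where q: "q \<in> star_words" "\<phi> = plug q" by blast
    let ?q = "map (map_bletter Some) A @ [Brk q] @ map (map_bletter Some) B"
    have "?q \<in> star_words" using q by (simp add: star_words_def stars_map del: map_map)
    moreover have "plug ?q = (\<lambda>u. A @ [Brk (\<phi> u)] @ B)"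
      by (simp add: plug_append plug_Cons plug_letter_Brk plug_map fun_eq_iff q del: plug_letter.simps)
    ultimately show ?case by (metis imageI)
  qed
qed (auto intro: plug_in_contexts)

lemma inj_context: "\<phi> \<in> contexts \<Longrightarrow> inj \<phi>"
  by (induction rule: contexts.induct) (auto simp: inj_def)

text \<open>
  Two factors of one word, the first starting no later than the second: they are disjoint, or
  the second lies inside the first, or they properly overlap in \<open>Y\<close>. In the overlapping case \<open>C\<close>
  may be empty, and then the first factor is a proper prefix of the second.
\<close>

lemma factor_positions:
  assumes "A1 @ X1 @ B1 = A2 @ X2 @ B2" "length A1 \<le> length A2"
  obtains (disjoint) D where "A2 = A1 @ X1 @ D" "B1 = D @ X2 @ B2"
  | (nested) C D where "X1 = C @ X2 @ D" "A2 = A1 @ C" "B2 = D @ B1"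
  | (overlap) C Y D where "X1 = C @ Y" "X2 = Y @ D" "Y \<noteq> []" "D \<noteq> []" "A2 = A1 @ C" "B1 = D @ B2"
proof -
  from assms obtain C where C: "A2 = A1 @ C" "X1 @ B1 = C @ X2 @ B2"
  proof -
    from assms(1) obtain us where
      "A1 = A2 @ us \<and> us @ X1 @ B1 = X2 @ B2 \<or> A1 @ us = A2 \<and> X1 @ B1 = us @ X2 @ B2"
      using append_eq_append_conv2[of A1 "X1 @ B1" A2 "X2 @ B2"] by blast
    then show thesis using assms(2) that[of us] that[of "[]"] by auto
  qed
  then consider D where "X1 @ D = C" "B1 = D @ X2 @ B2" | Y where "X1 = C @ Y" "Y @ B1 = X2 @ B2"
    by (auto simp: append_eq_append_conv2)
  then show ?thesis
  proof cases
    case 1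
    then show ?thesis using disjoint C by auto
  next
    case 2
    then consider D where "Y = X2 @ D" "D @ B1 = B2" | D where "Y @ D = X2" "B1 = D @ B2"
      by (auto simp: append_eq_append_conv2)
    then show ?thesis
    proof cases
      case 1
      with 2 show ?thesis using nested C by auto
    next
      case Y: 2
      show ?thesis
      proof (cases "Y = []")
        case True
        with 2 Y C show ?thesis by (intro disjoint[of "[]"]) auto
      next
        case False
        show ?thesis
        proof (cases "D = []")
          case True
          with 2 Y C show ?thesis by (intro nested[of C "[]"]) auto
        next
          case False
          with 2 Y C \<open>Y \<noteq> []\<close> show ?thesis by (intro overlap[of C Y D]) auto
        qed
      qed
    qed
  qed
qed

section \<open>Operated ideals as spans\<close>

locale monic_system =
  fixes r :: "'x bword rel"
    and S :: "('x, 'k::idom) bpoly set"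
  assumes monomial_order: "monomial_order r"
    and monic: "monic_set r S"
begin

abbreviation less_word (infix "\<prec>" 50) where "u \<prec> v \<equiv> strict_less r u v"

abbreviation below where "below w \<equiv> {v. v \<prec> w}"

abbreviation lm :: "('x, 'k) bpoly \<Rightarrow> 'x bword" where "lm \<equiv> lead_mon r"

lemma
  shows wf_less: "wf {(u, v). u \<prec> v}"
    and less_total: "u \<prec> v \<or> u = v \<or> v \<prec> u"
    and less_irrefl: "\<not> u \<prec> u"
    and less_trans: "u \<prec> v \<Longrightarrow> v \<prec> w \<Longrightarrow> u \<prec> w"
    and le_trans: "(u, v) \<in> r \<Longrightarrow> (v, w) \<in> r \<Longrightarrow> (u, w) \<in> r"
    and le_antisym: "(u, v) \<in> r \<Longrightarrow> (v, u) \<in> r \<Longrightarrow> u = v"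
    and le_iff: "(u, v) \<in> r \<longleftrightarrow> u = v \<or> u \<prec> v"
proof -
  have wo: "well_order_on UNIV r"
    using monomial_order by (simp add: monomial_order_def)
  then have lin: "refl r" "trans r" "antisym r" "total r" and wf: "wf (r - Id)"
    by (simp_all add: well_order_on_def linear_order_on_def partial_order_on_def preorder_on_def)
  have "{(u, v). u \<prec> v} = r - Id"
    by (auto simp: strict_less_def)
  then show "wf {(u, v). u \<prec> v}" using wf by simp
  show "u \<prec> v \<or> u = v \<or> v \<prec> u"
    using lin(4) by (auto simp: strict_less_def total_on_def)
  show "\<not> u \<prec> u" by (simp add: strict_less_def)
  show "u \<prec> v \<Longrightarrow> v \<prec> w \<Longrightarrow> u \<prec> w"
    using lin(2,3) unfolding strict_less_def by (metis antisymD transD)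
  show "(u, v) \<in> r \<Longrightarrow> (v, w) \<in> r \<Longrightarrow> (u, w) \<in> r"
    using lin(2) by (rule transD)
  show "(u, v) \<in> r \<Longrightarrow> (v, u) \<in> r \<Longrightarrow> u = v"
    using lin(3) by (rule antisymD)
  show "(u, v) \<in> r \<longleftrightarrow> u = v \<or> u \<prec> v"
    using lin(1) by (auto simp: strict_less_def refl_on_def)
qed

lemma context_mono: "\<phi> \<in> contexts \<Longrightarrow> u \<prec> v \<Longrightarrow> \<phi> u \<prec> \<phi> v"
  using monomial_order by (auto simp: contexts_eq_plug monomial_order_def)

text \<open>
  A word \<open>v\<close> below the empty word would give the descending chain \<open>v > v v > v v v v > \<dots>\<close>.
  This ensures that leading monomials of monic, hence non-constant, polynomials are non-empty.
\<close>

lemma not_less_Nil: "\<not> u \<prec> []"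
proof
  assume "u \<prec> []"
  then obtain v where v: "v \<prec> []" "\<And>w. w \<prec> v \<Longrightarrow> \<not> w \<prec> []"
    using wfE_min[OF wf_less, of u "below []"] by auto
  have "v @ v \<prec> v"
    using context_mono[OF contexts_append_left[of v] v(1)] by simp
  then show False using v less_trans by blast
qed

lemma exists_greatest: "finite A \<Longrightarrow> A \<noteq> {} \<Longrightarrow> \<exists>u\<in>A. \<forall>v\<in>A. (v, u) \<in> r"
proof (induction A rule: finite_ne_induct)
  case (singleton x)
  then show ?case by (simp add: le_iff)
next
  case (insert x F)
  then obtain u where u: "u \<in> F" "\<forall>v\<in>F. (v, u) \<in> r" by blast
  show ?case
  proof (cases "(x, u) \<in> r")
    case True
    then show ?thesis using u by blast
  next
    case False
    then have "(u, x) \<in> r" "(x, x) \<in> r"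
      using less_total[of x u] le_iff[of u x] le_iff[of x u] le_iff[of x x] by auto
    then have "\<forall>v\<in>insert x F. (v, x) \<in> r" using u le_trans by blast
    then show ?thesis by blast
  qed
qed

lemma keys_less_lm:
  assumes "f \<noteq> 0"
  shows "v \<in> Poly_Mapping.keys f \<Longrightarrow> v \<noteq> lm f \<Longrightarrow> v \<prec> lm f"
proof -
  let ?P = "\<lambda>u. u \<in> Poly_Mapping.keys f \<and> (\<forall>v\<in>Poly_Mapping.keys f. (v, u) \<in> r)"
  obtain u where u: "?P u"
    using exists_greatest[of "Poly_Mapping.keys f"] assms by auto
  have "lm f = u"
    unfolding lead_mon_def
  proof (rule the_equality)
    fix v assume "?P v"
    then have "(u, v) \<in> r" "(v, u) \<in> r" using u by blast+
    then show "v = u" using le_antisym by blast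
  qed (rule u)
  then have "?P (lm f)" using u by simp
  then show "v \<in> Poly_Mapping.keys f \<Longrightarrow> v \<noteq> lm f \<Longrightarrow> v \<prec> lm f"
    by (auto simp: le_iff)
qed

lemma
  assumes "s \<in> S"
  shows monic_lookup: "Poly_Mapping.lookup s (lm s) = 1"
    and monic_keys: "v \<in> Poly_Mapping.keys s \<Longrightarrow> v \<noteq> lm s \<Longrightarrow> v \<prec> lm s"
    and lm_not_Nil: "lm s \<noteq> []"
proof -
  have s: "s \<notin> constants" "Poly_Mapping.lookup s (lm s) = 1"
    using assms monic by (auto simp: monic_set_def monic_poly_def)
  then have "s \<noteq> 0" by auto
  then show *: "v \<in> Poly_Mapping.keys s \<Longrightarrow> v \<noteq> lm s \<Longrightarrow> v \<prec> lm s" for v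
    by (rule keys_less_lm)
  show "Poly_Mapping.lookup s (lm s) = 1" by fact
  show "lm s \<noteq> []"
  proof
    assume "lm s = []"
    then have "Poly_Mapping.lookup s v = 0" if "v \<noteq> []" for v
      using * not_less_Nil that by (metis in_keys_iff)
    then have "s = smul 1 1"
      using s(2) \<open>lm s = []\<close>
      by (intro poly_mapping_eqI) (auto simp: lookup_smul lookup_one zero_list_def when_def)
    with s(1) show False unfolding constants_def by blast
  qed
qed

text \<open>
  The bound is an arbitrary set of words so that one notion covers the full ideal (all words), the
  elements trivial modulo \<open>(S, w)\<close> (words below \<open>w\<close>) and the stages of the final induction
  (words up to \<open>w\<close>).
\<close>

definition multiples_within :: "'x bword set \<Rightarrow> ('x, 'k) bpoly set"
  where "multiples_within W =
    {linext \<phi> s | \<phi> s. \<phi> \<in> contexts \<and> s \<in> S \<and> \<phi> (lm s) \<in> W}"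

definition ideal_within :: "'x bword set \<Rightarrow> ('x, 'k) bpoly set"
  where "ideal_within W = bp.span (multiples_within W)"

lemma ideal_within_base:
  "\<phi> \<in> contexts \<Longrightarrow> s \<in> S \<Longrightarrow> \<phi> (lm s) \<in> W \<Longrightarrow> linext \<phi> s \<in> ideal_within W"
  unfolding ideal_within_def by (rule bp.span_base) (auto simp: multiples_within_def)

lemmas ideal_within_0 = bp.span_zero[where S = "multiples_within W" for W, folded ideal_within_def]
lemmas ideal_within_add = bp.span_add[where S = "multiples_within W" for W, folded ideal_within_def]
lemmas ideal_within_diff = bp.span_diff[where S = "multiples_within W" for W, folded ideal_within_def]
lemmas ideal_within_smul = bp.span_scale[where S = "multiples_within W" for W, folded ideal_within_def]
lemmas ideal_within_sum = bp.span_sum[where S = "multiples_within W" for W, folded ideal_within_def]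

lemmas ideal_within_closed =
  ideal_within_0 ideal_within_add ideal_within_diff ideal_within_smul ideal_within_sum

lemma ideal_within_induct [consumes 1, case_names zero step]:
  assumes "h \<in> ideal_within W" "P 0"
    and step: "\<And>c \<phi> s f. \<phi> \<in> contexts \<Longrightarrow> s \<in> S \<Longrightarrow> \<phi> (lm s) \<in> W \<Longrightarrow> f \<in> ideal_within W \<Longrightarrow> P f \<Longrightarrow>
      P (smul c (linext \<phi> s) + f)"
  shows "P h"
proof -
  have "h \<in> ideal_within W \<and> P h"
    using assms(1)[unfolded ideal_within_def]
  proof (induction rule: bp.span_induct_alt)
    case base
    show ?case using assms(2) ideal_within_0 by simp
  next
    case (step c x y)
    then obtain \<phi> s where x: "x = linext \<phi> s" "\<phi> \<in> contexts" "s \<in> S" "\<phi> (lm s) \<in> W"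
      by (auto simp: multiples_within_def)
    then show ?case
      using step assms(3)[OF x(2-4)] ideal_within_add ideal_within_smul ideal_within_base[OF x(2-4)] by simp
  qed
  then show ?thesis ..
qed

lemma ideal_within_mono: "W \<subseteq> V \<Longrightarrow> h \<in> ideal_within W \<Longrightarrow> h \<in> ideal_within V"
  unfolding ideal_within_def
  by (rule subsetD[OF bp.span_mono]) (auto simp: multiples_within_def)

lemma linext_ideal_within:
  assumes "h \<in> ideal_within W" "\<psi> \<in> contexts" "\<And>w. w \<in> W \<Longrightarrow> \<psi> w \<in> V"
  shows "linext \<psi> h \<in> ideal_within V"
  using assms(1)
proof (induction rule: ideal_within_induct)
  case zero
  then show ?case by (simp add: linext_0 ideal_within_closed)
next
  case (step c \<phi> s f)
  have "linext (\<lambda>u. \<psi> (\<phi> u)) s \<in> ideal_within V"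
    using step assms by (intro ideal_within_base contexts_comp[of \<psi> \<phi>]) auto
  then show ?case
    using step by (simp add: linext_add linext_smul linext_linext ideal_within_add ideal_within_smul)
qed

lemma
  assumes "\<phi> \<in> contexts" "s \<in> S"
  shows lookup_linext_lm: "Poly_Mapping.lookup (linext \<phi> s) (\<phi> (lm s)) = 1"
    and keys_linext_less: "v \<in> Poly_Mapping.keys (linext \<phi> s) \<Longrightarrow> v \<noteq> \<phi> (lm s) \<Longrightarrow> v \<prec> \<phi> (lm s)"
proof -
  show "Poly_Mapping.lookup (linext \<phi> s) (\<phi> (lm s)) = 1"
    using assms by (simp add: lookup_linext_inj inj_context monic_lookup)
  assume "v \<in> Poly_Mapping.keys (linext \<phi> s)" "v \<noteq> \<phi> (lm s)"
  then obtain u where "v = \<phi> u" "u \<in> Poly_Mapping.keys s" "u \<noteq> lm s"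
    using keys_linext[of \<phi> s] by blast
  then show "v \<prec> \<phi> (lm s)" using assms context_mono monic_keys by blast
qed

lemma keys_ideal_within_below:
  assumes "h \<in> ideal_within (below w)"
  shows "Poly_Mapping.keys h \<subseteq> below w"
  using assms
proof (induction rule: ideal_within_induct)
  case (step c \<phi> s f)
  have "Poly_Mapping.keys (smul c (linext \<phi> s)) \<subseteq> Poly_Mapping.keys (linext \<phi> s)"
    by (auto simp: in_keys_iff lookup_smul)
  moreover have "Poly_Mapping.keys (linext \<phi> s) \<subseteq> below w"
    using step(1-3) keys_linext_less less_trans by blast
  ultimately show ?case
    using step(5) keys_add[of "smul c (linext \<phi> s)" f] by blast
qed simp

text \<open>
  The span of the \<open>\<phi>(s)\<close> is an operated ideal because prefixing, suffixing and bracketing a context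
  yields a context; conversely these three operations build every context, so any operated
  ideal containing \<open>S\<close> contains all \<open>\<phi>(s)\<close>.
\<close>

lemma operated_Id_eq: "operated_Id S = ideal_within UNIV"
proof
  have ctx: "linext \<psi> f \<in> ideal_within UNIV" if "f \<in> ideal_within UNIV" "\<psi> \<in> contexts" for \<psi> f
    using that by (rule linext_ideal_within) simp
  have "g * f \<in> ideal_within UNIV" "f * g \<in> ideal_within UNIV" if "f \<in> ideal_within UNIV" for f g
    unfolding mult_eq_sum_linext(1)[of g f] mult_eq_sum_linext(2)[of f g]
    using that by (auto intro!: ideal_within_smul ideal_within_sum ctx contexts_append_left contexts_append_right)
  then have "operated_ideal (ideal_within UNIV)"
    by (auto simp: operated_ideal_def bracket_def intro: ideal_within_closed ctx contexts_Brk)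
  moreover have "S \<subseteq> ideal_within UNIV"
    using ideal_within_base[OF contexts_ident] by (auto simp: linext_ident)
  ultimately show "operated_Id S \<subseteq> ideal_within UNIV"
    by (auto simp: operated_Id_def)
next
  have "h \<in> I" if "h \<in> ideal_within UNIV" and I: "operated_ideal I" "S \<subseteq> I" for h I
  proof -
    have sum: "f + g \<in> I" if "f \<in> I" "g \<in> I" for f g
      using that I by (auto simp: operated_ideal_def)
    have mult: "g * f \<in> I" "f * g \<in> I" if "f \<in> I" for f g
      using that I by (auto simp: operated_ideal_def)
    have scale: "smul c f \<in> I" if "f \<in> I" for c f
      using mult(1)[OF that, of "Poly_Mapping.single [] c"]
      by (simp add: single_mult_eq_linext linext_ident)
    have frame: "linext (\<lambda>u. A @ u @ B) f \<in> I" if "f \<in> I" for A B f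
      using mult(1)[OF mult(2)[OF that, of "mono_of B"], of "mono_of A"]
      by (simp add: mono_of_def single_mult_eq_linext mult_single_eq_linext linext_linext)
    have elem: "linext \<phi> s \<in> I" if "\<phi> \<in> contexts" "s \<in> S" for \<phi> s
      using that(1)
    proof (induction rule: contexts.induct)
      case (hole A B)
      then show ?case using that I frame by blast
    next
      case (brk \<phi> A B)
      then have "bracket (linext \<phi> s) \<in> I" using I by (auto simp: operated_ideal_def)
      from frame[OF this, of A B] show ?case
        by (simp add: bracket_def linext_linext)
    qed
    from that(1) show "h \<in> I"
    proof (induction rule: ideal_within_induct)
      case zero
      then show ?case using I by (simp add: operated_ideal_def)
    next
      case (step c \<phi> s f)
      then show ?case by (intro sum scale elem)
    qed
  qed
  then show "ideal_within UNIV \<subseteq> operated_Id S"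
    by (auto simp: operated_Id_def)
qed

lemma trivial_mod_iff: "trivial_mod r S w h \<longleftrightarrow> h \<in> ideal_within (below w)"
proof
  assume "trivial_mod r S w h"
  then obtain n c q s where h: "h = (\<Sum>i<n::nat. smul (c i) (plug_poly (q i) (s i)))"
    "\<forall>i<n. q i \<in> star_words \<and> s i \<in> S \<and> plug (q i) (lm (s i)) \<prec> w"
    by (auto simp: trivial_mod_def)
  then show "h \<in> ideal_within (below w)"
    by (auto simp: plug_poly_def intro!: ideal_within_closed ideal_within_base plug_in_contexts)
next
  assume "h \<in> ideal_within (below w)"
  then show "trivial_mod r S w h"
  proof (induction rule: ideal_within_induct)
    case zero
    show ?case unfolding trivial_mod_def by (rule exI[of _ 0]) auto
  next
    case (step c0 \<phi> s0 f)
    then obtain q0 where q0: "q0 \<in> star_words" "\<phi> = plug q0"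
      by (auto simp: contexts_eq_plug)
    from step obtain n c q s where f: "f = (\<Sum>i<n::nat. smul (c i) (plug_poly (q i) (s i)))"
      "\<forall>i<n. q i \<in> star_words \<and> s i \<in> S \<and> plug (q i) (lm (s i)) \<prec> w"
      by (auto simp: trivial_mod_def)
    have "smul c0 (linext \<phi> s0) + f =
        (\<Sum>i<Suc n. smul ((c(n := c0)) i) (plug_poly ((q(n := q0)) i) ((s(n := s0)) i)))"
      by (simp add: f(1) q0 plug_poly_def)
    moreover have "\<forall>i<Suc n. (q(n := q0)) i \<in> star_words \<and> (s(n := s0)) i \<in> S \<and>
        plug ((q(n := q0)) i) (lm ((s(n := s0)) i)) \<prec> w"
      using f(2) q0 step by (auto simp: less_Suc_eq)
    ultimately show ?case unfolding trivial_mod_def by blast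
  qed
qed

section \<open>Rewriting\<close>

abbreviation step where "step \<equiv> rewrite_step (rewrite_rules r S)"

text \<open>
  Since \<open>t - R = s\<close> for the leading monomial \<open>t\<close> and the remainder \<open>R\<close> of \<open>s\<close>, replacing \<open>\<phi>(t)\<close> by
  \<open>\<phi>(R)\<close> with coefficient \<open>c\<close> is the same as subtracting \<open>c \<phi>(s)\<close>.
\<close>

lemma step_iff:
  "step f g \<longleftrightarrow> (\<exists>\<phi>\<in>contexts. \<exists>s\<in>S. Poly_Mapping.lookup f (\<phi> (lm s)) \<noteq> 0 \<and>
    g = f - smul (Poly_Mapping.lookup f (\<phi> (lm s))) (linext \<phi> s))"
proof -
  have rule: "f - smul c (mono_of (\<phi> (lm s))) + smul c (linext \<phi> (remainder r s)) = f - smul c (linext \<phi> s)"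
    for c \<phi> and s f :: "('x, 'k) bpoly"
    by (simp add: remainder_def linext_diff linext_mono_of bp.scale_right_diff_distrib)
  show ?thesis
  proof
    assume "step f g"
    then obtain q s where q: "q \<in> star_words" "s \<in> S" and c: "Poly_Mapping.lookup f (plug q (lm s)) \<noteq> 0"
      and g: "g = f - smul (Poly_Mapping.lookup f (plug q (lm s))) (mono_of (plug q (lm s)))
        + smul (Poly_Mapping.lookup f (plug q (lm s))) (linext (plug q) (remainder r s))"
      unfolding rewrite_step_def rewrite_rules_def plug_poly_def by blast
    show "\<exists>\<phi>\<in>contexts. \<exists>s\<in>S. Poly_Mapping.lookup f (\<phi> (lm s)) \<noteq> 0 \<and>
        g = f - smul (Poly_Mapping.lookup f (\<phi> (lm s))) (linext \<phi> s)"
      using q c g[unfolded rule] plug_in_contexts by blast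
  next
    assume "\<exists>\<phi>\<in>contexts. \<exists>s\<in>S. Poly_Mapping.lookup f (\<phi> (lm s)) \<noteq> 0 \<and>
        g = f - smul (Poly_Mapping.lookup f (\<phi> (lm s))) (linext \<phi> s)"
    then obtain q s where "q \<in> star_words" "s \<in> S" "Poly_Mapping.lookup f (plug q (lm s)) \<noteq> 0"
      "g = f - smul (Poly_Mapping.lookup f (plug q (lm s))) (linext (plug q) s)"
      unfolding contexts_eq_plug by blast
    then show "step f g"
      unfolding rewrite_step_def rewrite_rules_def plug_poly_def rule[symmetric] by blast
  qed
qed

lemma Irr_iff: "w \<in> Irr r S \<longleftrightarrow> (\<forall>\<phi>\<in>contexts. \<forall>s\<in>S. w \<noteq> \<phi> (lm s))"
  by (auto simp: Irr_def contexts_eq_plug)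

text \<open>
  The rewritten monomial disappears and every new monomial is smaller than it, which is a descent
  in the multiset order on supports.
\<close>

lemma step_mult:
  assumes "step f g"
  shows "(mset_set (Poly_Mapping.keys g), mset_set (Poly_Mapping.keys f)) \<in> mult {(u, v). u \<prec> v}"
proof -
  from assms obtain \<phi> s where s: "\<phi> \<in> contexts" "s \<in> S" "Poly_Mapping.lookup f (\<phi> (lm s)) \<noteq> 0"
    "g = f - smul (Poly_Mapping.lookup f (\<phi> (lm s))) (linext \<phi> s)"
    by (auto simp: step_iff)
  let ?t = "\<phi> (lm s)" and ?F = "Poly_Mapping.keys f" and ?G = "Poly_Mapping.keys g"
  have t: "?t \<in> ?F - ?G"
    using s by (simp add: in_keys_iff lookup_minus lookup_smul lookup_linext_lm)
  have new: "u \<prec> ?t" if "u \<in> ?G - ?F" for u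
  proof -
    have "u \<in> Poly_Mapping.keys (linext \<phi> s)"
      using that s(4) by (auto simp: in_keys_iff lookup_minus lookup_smul)
    moreover have "u \<noteq> ?t" using t that by blast
    ultimately show ?thesis by (rule keys_linext_less[OF s(1,2)])
  qed
  have G: "mset_set ?G = mset_set (?F \<inter> ?G) + mset_set (?G - ?F)"
    using mset_set_Union[of "?F \<inter> ?G" "?G - ?F"] Int_Diff_Un[of ?G ?F] by (auto simp: Int_commute[of ?G ?F])
  have F: "mset_set ?F = mset_set (?F \<inter> ?G) + mset_set (?F - ?G)"
    using mset_set_Union[of "?F \<inter> ?G" "?F - ?G"] Int_Diff_Un[of ?F ?G] by auto
  have fin: "finite (?F - ?G)" "finite (?G - ?F)" by auto
  show ?thesis
    unfolding G F
  proof (rule one_step_implies_mult)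
    show "mset_set (?F - ?G) \<noteq> {#}"
      using t fin(1) by (auto simp: mset_set_empty_iff)
    show "\<forall>k\<in>#mset_set (?G - ?F). \<exists>j\<in>#mset_set (?F - ?G). (k, j) \<in> {(u, v). u \<prec> v}"
    proof
      fix k assume "k \<in># mset_set (?G - ?F)"
      then have "k \<prec> ?t" using new fin(2) by simp
      moreover have "?t \<in># mset_set (?F - ?G)" using t fin(1) by simp
      ultimately show "\<exists>j\<in>#mset_set (?F - ?G). (k, j) \<in> {(u, v). u \<prec> v}" by blast
    qed
  qed
qed

lemma wf_step: "wf {(g, f). step f g}"
  by (rule wf_subset[OF wf_inv_image[OF wf_mult[OF wf_less], of "\<lambda>f. mset_set (Poly_Mapping.keys f)"]])
    (auto simp: inv_image_def intro: step_mult)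

lemma terminating: "terminating (rewrite_rules r S)"
  using wf_step unfolding terminating_def wf_iff_no_infinite_down_chain by simp

text \<open>
  Reductions never leave a downward closed set of monomials, and neither do the leading monomials of
  the multiples that they subtract. This keeps track of the bound required by triviality modulo
  \<open>(S, w)\<close>.
\<close>

lemma steps_ideal_within:
  assumes "step\<^sup>*\<^sup>* f g" "Poly_Mapping.keys f \<subseteq> W" "\<And>u v. v \<in> W \<Longrightarrow> u \<prec> v \<Longrightarrow> u \<in> W"
  shows "f - g \<in> ideal_within W \<and> Poly_Mapping.keys g \<subseteq> W"
  using assms(1)
proof (induction rule: rtranclp_induct)
  case base
  then show ?case using assms(2) by (simp add: ideal_within_closed)
next
  case (step g h)
  from step(2) obtain \<phi> s where s: "\<phi> \<in> contexts" "s \<in> S" "Poly_Mapping.lookup g (\<phi> (lm s)) \<noteq> 0"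
    and h: "h = g - smul (Poly_Mapping.lookup g (\<phi> (lm s))) (linext \<phi> s)"
    by (auto simp: step_iff)
  let ?c = "Poly_Mapping.lookup g (\<phi> (lm s))"
  have W: "\<phi> (lm s) \<in> W" using s(3) step(3) by (auto simp: in_keys_iff)
  have "(f - g) + smul ?c (linext \<phi> s) \<in> ideal_within W"
    using step(3) ideal_within_base[OF s(1,2) W] by (intro ideal_within_add ideal_within_smul) auto
  moreover have "u \<in> W" if "u \<in> Poly_Mapping.keys h" for u
  proof (cases "u \<in> Poly_Mapping.keys g")
    case False
    then have "u \<in> Poly_Mapping.keys (linext \<phi> s)"
      using that h by (auto simp: in_keys_iff lookup_minus lookup_smul)
    then show ?thesis using keys_linext_less[OF s(1,2)] W assms(3) by blast
  qed (use step(3) in blast)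
  ultimately show ?case by (auto simp: h algebra_simps)
qed

lemma exists_normal_form: "\<exists>g. step\<^sup>*\<^sup>* f g \<and> Poly_Mapping.keys g \<subseteq> Irr r S"
proof (induction f rule: wf_induct_rule[OF wf_step])
  case (1 f)
  show ?case
  proof (cases "Poly_Mapping.keys f \<subseteq> Irr r S")
    case False
    then obtain \<phi> s where "\<phi> \<in> contexts" "s \<in> S" "\<phi> (lm s) \<in> Poly_Mapping.keys f"
      by (auto simp: Irr_iff)
    then obtain g where "step f g" by (auto simp: step_iff in_keys_iff)
    moreover from 1[of g] this obtain h where "step\<^sup>*\<^sup>* g h" "Poly_Mapping.keys h \<subseteq> Irr r S" by auto
    ultimately show ?thesis by (meson converse_rtranclp_into_rtranclp)
  qed blast
qed

lemma irreducible_steps: "step\<^sup>*\<^sup>* f g \<Longrightarrow> Poly_Mapping.keys f \<subseteq> Irr r S \<Longrightarrow> g = f"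
  by (induction rule: converse_rtranclp_induct) (auto simp: step_iff Irr_iff in_keys_iff subset_iff)

definition irr_independent :: bool
  where "irr_independent \<longleftrightarrow>
    (\<forall>h\<in>ideal_within UNIV. Poly_Mapping.keys h \<subseteq> Irr r S \<longrightarrow> h = 0)"

lemma irr_independent_iff: "operated_Id S \<inter> kspan (Irr r S) = {0} \<longleftrightarrow> irr_independent"
  using ideal_within_0[of UNIV]
  by (auto simp: operated_Id_eq kspan_eq irr_independent_def)

text \<open>
  The sum is always everything: \<open>f\<close> is the sum of a normal form of \<open>f\<close> and an element of the ideal.
\<close>

lemma direct_sum_whole_iff:
  "direct_sum_whole (operated_Id S) (kspan (Irr r S)) \<longleftrightarrow> irr_independent"
proof -
  have "f \<in> {u + v |u v. u \<in> operated_Id S \<and> v \<in> kspan (Irr r S)}" for f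
  proof -
    obtain g where g: "step\<^sup>*\<^sup>* f g" "Poly_Mapping.keys g \<subseteq> Irr r S"
      using exists_normal_form by blast
    have "f - g \<in> operated_Id S"
      using steps_ideal_within[OF g(1), of UNIV] by (simp add: operated_Id_eq)
    moreover have "f = (f - g) + g" by simp
    ultimately show ?thesis using g(2) unfolding kspan_eq by blast
  qed
  then show ?thesis
    using irr_independent_iff by (auto simp: direct_sum_whole_def)
qed

text \<open>
  Eliminating the leading monomial of \<open>\<phi>(s)\<close> from \<open>f\<close> or from \<open>f + c \<phi>(s)\<close> gives the same
  polynomial, and each elimination is at most one step (none if the coefficient is already \<open>0\<close>).
\<close>

lemma joinable_add_multiple:
  assumes "\<phi> \<in> contexts" "s \<in> S"
  shows "\<exists>g. step\<^sup>*\<^sup>* f g \<and> step\<^sup>*\<^sup>* (smul c (linext \<phi> s) + f) g"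
proof -
  let ?t = "\<phi> (lm s)" and ?e = "linext \<phi> s"
  have *: "step\<^sup>*\<^sup>* h (h - smul (Poly_Mapping.lookup h ?t) ?e)" for h
  proof (cases "Poly_Mapping.lookup h ?t = 0")
    case False
    then have "step h (h - smul (Poly_Mapping.lookup h ?t) ?e)"
      using assms by (auto simp: step_iff)
    then show ?thesis by blast
  qed simp
  have "Poly_Mapping.lookup (smul c ?e + f) ?t = c + Poly_Mapping.lookup f ?t"
    using assms by (simp add: lookup_add lookup_smul lookup_linext_lm)
  then have "smul c ?e + f - smul (Poly_Mapping.lookup (smul c ?e + f) ?t) ?e =
      f - smul (Poly_Mapping.lookup f ?t) ?e"
    by (simp add: bp.scale_left_distrib)
  then show ?thesis using *[of f] *[of "smul c ?e + f"] by metis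
qed

lemma confluent_iff: "confluent (rewrite_rules r S) \<longleftrightarrow> irr_independent"
proof
  assume "confluent (rewrite_rules r S)"
  then have conf: "confluentp step" by (simp add: confluent_def)
  have zero: "step\<^sup>*\<^sup>* h 0" if "h \<in> ideal_within UNIV" for h
    using that
  proof (induction rule: ideal_within_induct)
    case (step c \<phi> s f)
    \<comment> \<open>By induction \<open>f\<close> reduces to \<open>0\<close>, so its common reduct \<open>g\<close> with the new sum does as well.\<close>
    obtain g where g: "step\<^sup>*\<^sup>* f g" "step\<^sup>*\<^sup>* (smul c (linext \<phi> s) + f) g"
      using joinable_add_multiple step by blast
    obtain u where u: "step\<^sup>*\<^sup>* g u" "step\<^sup>*\<^sup>* 0 u"
      using confluentpD[OF conf g(1) step(5)] by blast
    have "u = 0" using irreducible_steps[OF u(2)] by simp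
    then show ?case using g u by simp
  qed simp
  show irr_independent
    unfolding irr_independent_def using zero irreducible_steps by metis
next
  assume indep: irr_independent
  show "confluent (rewrite_rules r S)"
    unfolding confluent_def
  proof (rule confluentpI)
    fix f g h assume fg: "step\<^sup>*\<^sup>* f g" and fh: "step\<^sup>*\<^sup>* f h"
    obtain g' where g': "step\<^sup>*\<^sup>* g g'" "Poly_Mapping.keys g' \<subseteq> Irr r S" using exists_normal_form by blast
    obtain h' where h': "step\<^sup>*\<^sup>* h h'" "Poly_Mapping.keys h' \<subseteq> Irr r S" using exists_normal_form by blast
    have "f - g' \<in> ideal_within UNIV" "f - h' \<in> ideal_within UNIV"
      using steps_ideal_within[of f _ UNIV] rtranclp_trans[OF fg g'(1)] rtranclp_trans[OF fh h'(1)] by auto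
    then have "(f - g') - (f - h') \<in> ideal_within UNIV" by (rule ideal_within_diff)
    moreover have "Poly_Mapping.keys ((f - g') - (f - h')) \<subseteq> Irr r S"
      using keys_diff[of h' g'] g'(2) h'(2) by auto
    ultimately have "(f - g') - (f - h') = 0"
      using indep unfolding irr_independent_def by blast
    then have "g' = h'" by simp
    then show "\<exists>u. step\<^sup>*\<^sup>* g u \<and> step\<^sup>*\<^sup>* h u" using g' h' by blast
  qed
qed

section \<open>Compositions\<close>

definition compositions_trivial :: bool
  where "compositions_trivial \<longleftrightarrow>
    (\<forall>f\<in>S. \<forall>g\<in>S. \<forall>w h.
      intersection_composition r f g w h \<or> including_composition r f g w h
        \<longrightarrow> h \<in> ideal_within (below w))"

lemma groebner_shirshov_basis_iff: "groebner_shirshov_basis r S \<longleftrightarrow> compositions_trivial"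
  unfolding groebner_shirshov_basis_def compositions_trivial_def trivial_mod_iff using monic by blast

text \<open>
  The leading monomials agree and both have coefficient \<open>1\<close>, so they cancel.
\<close>

lemma linext_diff_below:
  assumes "\<phi> \<in> contexts" "\<psi> \<in> contexts" "s \<in> S" "t \<in> S" "\<phi> (lm s) = \<psi> (lm t)"
  shows "linext \<phi> s - linext \<psi> t \<in> ideal_within UNIV"
    and "Poly_Mapping.keys (linext \<phi> s - linext \<psi> t) \<subseteq> below (\<phi> (lm s))"
proof -
  show "linext \<phi> s - linext \<psi> t \<in> ideal_within UNIV"
    by (rule ideal_within_diff; rule ideal_within_base[OF _ _ UNIV_I]; fact)
  show "Poly_Mapping.keys (linext \<phi> s - linext \<psi> t) \<subseteq> below (\<phi> (lm s))"
  proof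
    fix v assume v: "v \<in> Poly_Mapping.keys (linext \<phi> s - linext \<psi> t)"
    have "Poly_Mapping.lookup (linext \<phi> s - linext \<psi> t) (\<phi> (lm s)) = 0"
      using lookup_linext_lm[OF assms(1,3)] lookup_linext_lm[OF assms(2,4)]
      by (simp add: lookup_minus assms(5))
    then have "v \<noteq> \<phi> (lm s)"
      using v unfolding in_keys_iff by metis
    moreover have "v \<in> Poly_Mapping.keys (linext \<phi> s) \<union> Poly_Mapping.keys (linext \<psi> t)"
      using subsetD[OF keys_diff v] .
    ultimately have "v \<prec> \<phi> (lm s)"
      using keys_linext_less[OF assms(1,3), of v] keys_linext_less[OF assms(2,4), of v]
      unfolding assms(5)[symmetric] by blast
    then show "v \<in> below (\<phi> (lm s))" by simp
  qed
qed

text \<open>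
  Both kinds of composition have the shape \<open>\<phi>(f) - \<psi>(g)\<close> for contexts with
  a common leading monomial. Such a difference lies in the ideal and has only smaller monomials.
\<close>

lemma composition_as_difference:
  assumes "intersection_composition r f g w h \<or> including_composition r f g w h"
  obtains \<phi> \<psi> where "\<phi> \<in> contexts" "\<psi> \<in> contexts" "w = \<phi> (lm f)" "w = \<psi> (lm g)"
    "h = linext \<phi> f - linext \<psi> g"
  using assms
proof
  assume "intersection_composition r f g w h"
  then obtain \<mu> \<nu> where "w = lm f @ \<mu>" "w = \<nu> @ lm g" "h = f * mono_of \<mu> - mono_of \<nu> * g"
    unfolding intersection_composition_def by blast
  then show ?thesis
    using that[of "\<lambda>u. u @ \<mu>" "\<lambda>u. \<nu> @ u"] contexts_append_left[of \<nu>] contexts_append_right[of \<mu>]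
    by (simp add: mono_of_def single_mult_eq_linext mult_single_eq_linext)
next
  assume "including_composition r f g w h"
  then obtain q where "q \<in> star_words" "w = lm f" "w = plug q (lm g)" "h = f - plug_poly q g"
    by (auto simp: including_composition_def)
  then show ?thesis
    using that[of "\<lambda>u. u" "plug q"] contexts_ident plug_in_contexts[of q]
    by (simp add: linext_ident plug_poly_def)
qed

lemma compositions_trivial_if_independent:
  assumes irr_independent
  shows compositions_trivial
  unfolding compositions_trivial_def
proof (intro ballI allI impI)
  fix f g w h assume S: "f \<in> S" "g \<in> S"
    and comp: "intersection_composition r f g w h \<or> including_composition r f g w h"
  from comp obtain \<phi> \<psi> where c: "\<phi> \<in> contexts" "\<psi> \<in> contexts" "w = \<phi> (lm f)" "w = \<psi> (lm g)"
    "h = linext \<phi> f - linext \<psi> g"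
    by (rule composition_as_difference)
  have h: "h \<in> ideal_within UNIV" "Poly_Mapping.keys h \<subseteq> below w"
    using linext_diff_below[OF c(1,2) S] c by simp_all
  obtain h' where h': "step\<^sup>*\<^sup>* h h'" "Poly_Mapping.keys h' \<subseteq> Irr r S"
    using exists_normal_form by blast
  have below: "h - h' \<in> ideal_within (below w)"
    using steps_ideal_within[OF h'(1) h(2)] less_trans by blast
  have "h - (h - h') \<in> ideal_within UNIV"
    using h(1) ideal_within_mono[OF subset_UNIV below] by (rule ideal_within_diff)
  then have "h' = 0" using assms h'(2) by (simp add: irr_independent_def)
  then show "h \<in> ideal_within (below w)" using below by simp
qed

section \<open>Two occurrences of leading monomials in one word\<close>

abbreviation resolvable ::
    "('x bword \<Rightarrow> 'x bword) \<Rightarrow> ('x, 'k) bpoly \<Rightarrow> ('x bword \<Rightarrow> 'x bword) \<Rightarrow> ('x, 'k) bpoly \<Rightarrow> bool"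
  where "resolvable \<phi> s \<psi> t \<equiv> linext \<phi> s - linext \<psi> t \<in> ideal_within (below (\<phi> (lm s)))"

lemma resolvable_sym: "resolvable \<phi> s \<psi> t \<Longrightarrow> \<phi> (lm s) = \<psi> (lm t) \<Longrightarrow> resolvable \<psi> t \<phi> s"
  using ideal_within_smul[of "linext \<phi> s - linext \<psi> t" "below (\<phi> (lm s))" "-1"] by simp

lemma resolvable_in_context:
  assumes "resolvable \<phi> s \<psi> t" "\<chi> \<in> contexts"
  shows "resolvable (\<lambda>u. \<chi> (\<phi> u)) s (\<lambda>u. \<chi> (\<psi> u)) t"
  using linext_ideal_within[OF assms, of "below (\<chi> (\<phi> (lm s)))"] context_mono[OF assms(2)]
  by (simp add: linext_diff linext_linext)

text \<open>
  Let \<open>F\<close> be a word with two independent holes and consider the bilinear extension \<open>F(s, t)\<close>.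
  Expanding it in the second argument gives the leading term \<open>F(s, lm t)\<close> plus
  multiples of \<open>s\<close> with smaller leading monomials; expanding it in the first argument gives \<open>F(lm s, t)\<close>
  plus multiples of \<open>t\<close> with smaller leading monomials. Subtracting the two expansions gives the
  claim.
\<close>

lemma resolvable_disjoint:
  assumes F: "\<And>v. (\<lambda>u. F u v) \<in> contexts" "\<And>u. (\<lambda>v. F u v) \<in> contexts"
    and S: "s \<in> S" "t \<in> S"
  shows "resolvable (\<lambda>u. F u (lm t)) s (\<lambda>v. F (lm s) v) t"
proof -
  let ?K = "Poly_Mapping.keys" and ?l = "Poly_Mapping.lookup"
  let ?J = "ideal_within (below (F (lm s) (lm t)))"
  have key: "lm s \<in> ?K s" "lm t \<in> ?K t" using S by (simp_all add: in_keys_iff monic_lookup)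
  define B where "B = (\<Sum>v\<in>?K t. smul (?l t v) (linext (\<lambda>u. F u v) s))"
  have B': "B = (\<Sum>u\<in>?K s. smul (?l s u) (linext (\<lambda>v. F u v) t))"
    unfolding B_def linext_def bp.scale_sum_right
    by (subst sum.swap) (simp add: mult.commute)
  have "B = linext (\<lambda>u. F u (lm t)) s + (\<Sum>v\<in>?K t - {lm t}. smul (?l t v) (linext (\<lambda>u. F u v) s))"
    unfolding B_def using key by (subst sum.remove[of _ "lm t"]) (simp_all add: monic_lookup S)
  moreover have "B = linext (\<lambda>v. F (lm s) v) t + (\<Sum>u\<in>?K s - {lm s}. smul (?l s u) (linext (\<lambda>v. F u v) t))"
    unfolding B' using key by (subst sum.remove[of _ "lm s"]) (simp_all add: monic_lookup S)
  ultimately have "linext (\<lambda>u. F u (lm t)) s - linext (\<lambda>v. F (lm s) v) t =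
      (\<Sum>u\<in>?K s - {lm s}. smul (?l s u) (linext (\<lambda>v. F u v) t)) -
      (\<Sum>v\<in>?K t - {lm t}. smul (?l t v) (linext (\<lambda>u. F u v) s))"
    by (simp add: algebra_simps)
  also have "\<dots> \<in> ?J"
  proof (rule ideal_within_diff; rule ideal_within_sum; rule ideal_within_smul)
    fix u assume "u \<in> ?K s - {lm s}"
    then have "F u (lm t) \<prec> F (lm s) (lm t)"
      using context_mono[OF F(1)] monic_keys[OF S(1)] by blast
    then show "linext (\<lambda>v. F u v) t \<in> ?J"
      using F S by (intro ideal_within_base) auto
  next
    fix v assume "v \<in> ?K t - {lm t}"
    then have "F (lm s) v \<prec> F (lm s) (lm t)"
      using context_mono[OF F(2)] monic_keys[OF S(2)] by blast
    then show "linext (\<lambda>u. F u v) s \<in> ?J"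
      using F S by (intro ideal_within_base) auto
  qed
  finally show ?thesis .
qed

lemma resolvable_separate:
  assumes "\<alpha> \<in> contexts" "\<beta> \<in> contexts" "s \<in> S" "t \<in> S"
  shows "resolvable (\<lambda>u. A @ \<alpha> u @ D @ \<beta> (lm t) @ B) s (\<lambda>v. A @ \<alpha> (lm s) @ D @ \<beta> v @ B) t"
proof (rule resolvable_disjoint[where F = "\<lambda>u v. A @ \<alpha> u @ D @ \<beta> v @ B"])
  show "(\<lambda>u. A @ \<alpha> u @ D @ \<beta> v @ B) \<in> contexts" for v
    using contexts_frame[OF assms(1), of A "D @ \<beta> v @ B"] .
  show "(\<lambda>v. A @ \<alpha> u @ D @ \<beta> v @ B) \<in> contexts" for u
    using contexts_frame[OF assms(2), of "A @ \<alpha> u @ D" B] by simp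
qed fact+

context
  assumes compositions: compositions_trivial
begin

lemma resolvable_nested:
  assumes "s \<in> S" "t \<in> S" "\<chi> \<in> contexts" "lm s = \<chi> (lm t)"
  shows "resolvable (\<lambda>u. A @ u @ B) s (\<lambda>u. A @ \<chi> u @ B) t"
proof -
  obtain q where q: "q \<in> star_words" "\<chi> = plug q"
    using assms(3) by (auto simp: contexts_eq_plug)
  have "including_composition r s t (lm s) (s - linext \<chi> t)"
    using assms q by (auto simp: including_composition_def plug_poly_def)
  then have "s - linext \<chi> t \<in> ideal_within (below (lm s))"
    using compositions[unfolded compositions_trivial_def, rule_format, OF assms(1,2)] by blast
  then have "resolvable (\<lambda>u. u) s \<chi> t" by (simp add: linext_ident)
  from resolvable_in_context[OF this contexts.hole] show ?thesis .
qed

lemma resolvable_overlap: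
  assumes "s \<in> S" "t \<in> S" "lm s = C @ Y" "lm t = Y @ D" "C \<noteq> []" "Y \<noteq> []" "D \<noteq> []"
  shows "resolvable (\<lambda>u. A @ u @ D @ B) s (\<lambda>u. A @ C @ u @ B) t"
proof -
  have "intersection_composition r s t (C @ Y @ D) (linext (\<lambda>u. u @ D) s - linext (\<lambda>u. C @ u) t)"
    unfolding intersection_composition_def
    using assms by (intro exI[of _ D] exI[of _ C])
      (simp add: mono_of_def single_mult_eq_linext mult_single_eq_linext)
  then have "linext (\<lambda>u. u @ D) s - linext (\<lambda>u. C @ u) t \<in> ideal_within (below (C @ Y @ D))"
    using compositions[unfolded compositions_trivial_def, rule_format, OF assms(1,2)] by blast
  then have "resolvable (\<lambda>u. u @ D) s (\<lambda>u. C @ u) t" using assms by simp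
  from resolvable_in_context[OF this contexts.hole] show ?thesis by simp
qed

lemma resolvable_hole_hole_le:
  assumes S: "s \<in> S" "t \<in> S"
    and eq: "A1 @ lm s @ B1 = A2 @ lm t @ B2" and le: "length A1 \<le> length A2"
  shows "resolvable (\<lambda>u. A1 @ u @ B1) s (\<lambda>u. A2 @ u @ B2) t"
  using eq le
proof (cases rule: factor_positions)
  case (disjoint D)
  then show ?thesis
    using resolvable_separate[OF contexts_ident contexts_ident S, of A1 D B2] by simp
next
  case (nested C D)
  then show ?thesis
    using resolvable_nested[OF S contexts.hole, of C D A1 B1] by simp
next
  case (overlap C Y D)
  show ?thesis
  proof (cases "C = []")
    case True
    \<comment> \<open>The leading monomial of \<open>s\<close> is a proper prefix of that of \<open>t\<close>: an including composition with the roles exchanged.\<close>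
    then have "resolvable (\<lambda>u. A1 @ u @ B2) t (\<lambda>u. A1 @ (u @ D) @ B2) s"
      using overlap resolvable_nested[OF S(2,1) contexts_append_right, of D A1 B2] by simp
    then have "resolvable (\<lambda>u. A2 @ u @ B2) t (\<lambda>u. A1 @ u @ B1) s"
      using overlap True by simp
    then show ?thesis by (rule resolvable_sym) (simp add: eq)
  next
    case False
    then show ?thesis
      using resolvable_overlap[OF S, of C Y D A1 B2] overlap by simp
  qed
qed

lemma resolvable_hole_hole:
  assumes "s \<in> S" "t \<in> S" "A1 @ lm s @ B1 = A2 @ lm t @ B2"
  shows "resolvable (\<lambda>u. A1 @ u @ B1) s (\<lambda>u. A2 @ u @ B2) t"
proof (cases "length A1 \<le> length A2")
  case True
  then show ?thesis using resolvable_hole_hole_le[OF assms] by simp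
next
  case False
  then have "resolvable (\<lambda>u. A2 @ u @ B2) t (\<lambda>u. A1 @ u @ B1) s"
    using resolvable_hole_hole_le[OF assms(2,1) assms(3)[symmetric]] by simp
  then show ?thesis by (rule resolvable_sym) (simp add: assms(3))
qed

text \<open>
  A bracketed letter cannot be split, so it lies entirely outside or inside the occurrence of
  \<open>lm s\<close>; in the latter case the second occurrence is nested in the first.
\<close>

lemma resolvable_hole_Brk:
  assumes S: "s \<in> S" "t \<in> S" and \<psi>: "\<psi> \<in> contexts"
    and eq: "A1 @ lm s @ B1 = A2 @ [Brk (\<psi> (lm t))] @ B2"
  shows "resolvable (\<lambda>u. A1 @ u @ B1) s (\<lambda>u. A2 @ [Brk (\<psi> u)] @ B2) t"
proof -
  have b: "(\<lambda>u. [Brk (\<psi> u)]) \<in> contexts" using contexts.brk[OF \<psi>, of "[]" "[]"] by simp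
  have nest: ?thesis if "lm s = C @ [Brk (\<psi> (lm t))] @ D" "A2 = A1 @ C" "B2 = D @ B1" for C D
    using resolvable_nested[OF S contexts.brk[OF \<psi>], of C D A1 B1] that by simp
  show ?thesis
  proof (cases "length A1 \<le> length A2")
    case True
    show ?thesis
      using eq True
    proof (cases rule: factor_positions)
      case (disjoint D)
      then show ?thesis
        using resolvable_separate[OF contexts_ident b S, of A1 D B2] by simp
    next
      case (nested C D)
      then show ?thesis by (rule nest)
    next
      case (overlap C Y D)
      then show ?thesis by (auto simp: Cons_eq_append_conv)
    qed
  next
    case False
    then have "length A2 \<le> length A1" by simp
    with eq[symmetric] show ?thesis
    proof (cases rule: factor_positions)
      case (disjoint D)
      then have "resolvable (\<lambda>u. A2 @ [Brk (\<psi> u)] @ B2) t (\<lambda>u. A1 @ u @ B1) s"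
        using resolvable_separate[OF b contexts_ident S(2,1), of A2 D B1] by simp
      then show ?thesis by (rule resolvable_sym) (use eq in simp)
    next
      case (nested C D)
      then have "C = []" "D = []" "lm s = [Brk (\<psi> (lm t))]"
        using lm_not_Nil[OF S(1)] by (auto simp: Cons_eq_append_conv)
      then show ?thesis using nested nest[of "[]" "[]"] by simp
    next
      case (overlap C Y D)
      then have "C = []" "Y = [Brk (\<psi> (lm t))]" by (auto simp: Cons_eq_append_conv)
      then show ?thesis using overlap nest[of "[]" D] by simp
    qed
  qed
qed

text \<open>
  Two single letters are either disjoint or the same letter, and in the latter case both
  occurrences lie inside the same bracket.
\<close>

lemma resolvable_Brk_Brk_le:
  assumes S: "s \<in> S" "t \<in> S" and \<phi>: "\<phi> \<in> contexts" and \<psi>: "\<psi> \<in> contexts"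
    and eq: "A1 @ [Brk (\<phi> (lm s))] @ B1 = A2 @ [Brk (\<psi> (lm t))] @ B2" and le: "length A1 \<le> length A2"
    and inner: "\<phi> (lm s) = \<psi> (lm t) \<Longrightarrow> resolvable \<phi> s \<psi> t"
  shows "resolvable (\<lambda>u. A1 @ [Brk (\<phi> u)] @ B1) s (\<lambda>u. A2 @ [Brk (\<psi> u)] @ B2) t"
proof -
  have same: ?thesis if "\<phi> (lm s) = \<psi> (lm t)" "A2 = A1" "B2 = B1"
    using resolvable_in_context[OF inner[OF that(1)] contexts.brk[OF contexts_ident, of A1 B1]] that by simp
  show ?thesis
    using eq le
  proof (cases rule: factor_positions)
    case (disjoint D)
    have b: "(\<lambda>u. [Brk (\<phi> u)]) \<in> contexts" "(\<lambda>u. [Brk (\<psi> u)]) \<in> contexts"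
      using contexts.brk[of _ "[]" "[]"] \<phi> \<psi> by simp_all
    from disjoint show ?thesis
      using resolvable_separate[OF b S, of A1 D B2] by simp
  next
    case (nested C D)
    then show ?thesis using same by (auto simp: Cons_eq_append_conv)
  next
    case (overlap C Y D)
    then show ?thesis by (auto simp: Cons_eq_append_conv)
  qed
qed

text \<open>
  Induction on the first context: the comparison descends through common
  brackets until one of the two holes is at the current level.
\<close>

lemma resolvable:
  assumes "\<phi> \<in> contexts" "\<psi> \<in> contexts" "s \<in> S" "t \<in> S" "\<phi> (lm s) = \<psi> (lm t)"
  shows "resolvable \<phi> s \<psi> t"
  using assms(1,2,5)
proof (induction arbitrary: \<psi> rule: contexts.induct)
  case (hole A B)
  from hole(1) show ?case
  proof cases
    case (hole A2 B2)
    then show ?thesis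
      using \<open>A @ lm s @ B = \<psi> (lm t)\<close> resolvable_hole_hole[OF assms(3,4), of A B A2 B2] by simp
  next
    case (brk \<psi>' A2 B2)
    then show ?thesis
      using \<open>A @ lm s @ B = \<psi> (lm t)\<close> resolvable_hole_Brk[OF assms(3,4) brk(2)] by simp
  qed
next
  case (brk \<phi> A B)
  note eq = \<open>A @ [Brk (\<phi> (lm s))] @ B = \<psi> (lm t)\<close>
  from \<open>\<psi> \<in> contexts\<close> show ?case
  proof cases
    case (hole A2 B2)
    then have "resolvable \<psi> t (\<lambda>u. A @ [Brk (\<phi> u)] @ B) s"
      using eq resolvable_hole_Brk[OF assms(4,3) brk(1), of A2 B2 A B] by simp
    then show ?thesis by (rule resolvable_sym) (use eq in simp)
  next
    case \<psi>: (brk \<psi>' A2 B2)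
    have inner: "resolvable \<phi> s \<psi>' t" if "\<phi> (lm s) = \<psi>' (lm t)"
      using brk.IH \<psi>(2) that by blast
    show ?thesis
    proof (cases "length A \<le> length A2")
      case True
      then show ?thesis
        using resolvable_Brk_Brk_le[OF assms(3,4) brk(1) \<psi>(2)] eq \<psi>(1) inner by simp
    next
      case False
      have "resolvable (\<lambda>u. A2 @ [Brk (\<psi>' u)] @ B2) t (\<lambda>u. A @ [Brk (\<phi> u)] @ B) s"
      proof (rule resolvable_Brk_Brk_le[OF assms(4,3) \<psi>(2) brk(1)])
        assume e: "\<psi>' (lm t) = \<phi> (lm s)"
        show "resolvable \<psi>' t \<phi> s"
          by (rule resolvable_sym[OF inner[OF e[symmetric]] e[symmetric]])
      qed (use False eq \<psi>(1) in simp_all)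
      then show ?thesis unfolding \<psi>(1) by (rule resolvable_sym) (use eq \<psi>(1) in simp)
    qed
  qed
qed

section \<open>Triviality of compositions forces independence\<close>

text \<open>
  All multiples with leading monomial exactly \<open>w\<close> agree modulo smaller ones by \<open>resolvable\<close>, so one
  of them represents the whole top part of \<open>h\<close>.
\<close>

lemma ideal_within_le_cases:
  assumes "h \<in> ideal_within {v. (v, w) \<in> r}"
  shows "h \<in> ideal_within (below w) \<or>
    (\<exists>\<phi>\<in>contexts. \<exists>s\<in>S. \<exists>c. \<phi> (lm s) = w \<and> h - smul c (linext \<phi> s) \<in> ideal_within (below w))"
proof (cases "\<exists>\<psi>\<in>contexts. \<exists>t\<in>S. \<psi> (lm t) = w")
  case True
  then obtain \<psi> t where t: "\<psi> \<in> contexts" "t \<in> S" "\<psi> (lm t) = w" by blast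
  have "\<exists>c. h - smul c (linext \<psi> t) \<in> ideal_within (below w)"
    using assms
  proof (induction rule: ideal_within_induct)
    case zero
    show ?case using ideal_within_0 by (intro exI[of _ 0]) simp
  next
    case (step c \<phi> s f)
    then obtain d where d: "f - smul d (linext \<psi> t) \<in> ideal_within (below w)" by blast
    show ?case
    proof (cases "\<phi> (lm s) = w")
      case True
      then have "linext \<phi> s - linext \<psi> t \<in> ideal_within (below w)"
        using resolvable[OF step(1) t(1) step(2) t(2)] t(3) by simp
      then have "smul c (linext \<phi> s - linext \<psi> t) + (f - smul d (linext \<psi> t)) \<in> ideal_within (below w)"
        using d by (intro ideal_within_add ideal_within_smul)
      then show ?thesis
        by (intro exI[of _ "c + d"]) (simp add: bp.scale_left_distrib bp.scale_right_diff_distrib algebra_simps)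
    next
      case False
      then have "\<phi> (lm s) \<prec> w" using step(3) by (simp add: strict_less_def)
      then have "smul c (linext \<phi> s) + (f - smul d (linext \<psi> t)) \<in> ideal_within (below w)"
        using d step(1,2) by (intro ideal_within_add ideal_within_smul ideal_within_base) auto
      then show ?thesis by (intro exI[of _ d]) (simp add: algebra_simps)
    qed
  qed
  then show ?thesis using t by blast
next
  case False
  then have "multiples_within {v. (v, w) \<in> r} = multiples_within (below w)"
    unfolding multiples_within_def strict_less_def by blast
  then show ?thesis using assms by (simp add: ideal_within_def)
qed

lemma ideal_within_bounded:
  "h \<in> ideal_within W \<Longrightarrow> h = 0 \<or> (\<exists>w\<in>W. h \<in> ideal_within {v. (v, w) \<in> r})"
proof (induction rule: ideal_within_induct)
  case (step c \<phi> s f)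
  let ?t = "\<phi> (lm s)"
  have mult: "smul c (linext \<phi> s) \<in> ideal_within {v. (v, w) \<in> r}" if "(?t, w) \<in> r" for w
    using step that by (intro ideal_within_smul ideal_within_base) auto
  have refl: "(?t, ?t) \<in> r" by (simp add: le_iff)
  from step(5) show ?case
  proof
    assume "f = 0"
    then show ?thesis using step(3) mult[OF refl] by auto
  next
    assume "\<exists>w\<in>W. f \<in> ideal_within {v. (v, w) \<in> r}"
    then obtain w where w: "w \<in> W" "f \<in> ideal_within {v. (v, w) \<in> r}" by blast
    show ?thesis
    proof (cases "(?t, w) \<in> r")
      case True
      then have "smul c (linext \<phi> s) + f \<in> ideal_within {v. (v, w) \<in> r}"
        using w mult by (intro ideal_within_add)
      then show ?thesis using w by blast
    next
      case False
      then have "(w, ?t) \<in> r"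
        using less_total[of w ?t] le_iff[of w ?t] le_iff[of ?t w] by auto
      then have "f \<in> ideal_within {v. (v, ?t) \<in> r}"
        using le_trans by (intro ideal_within_mono[OF _ w(2)]) blast
      then have "smul c (linext \<phi> s) + f \<in> ideal_within {v. (v, ?t) \<in> r}"
        using mult[OF refl] by (intro ideal_within_add)
      then show ?thesis using step(3) by blast
    qed
  qed
qed simp

text \<open>
  The monomial \<open>w\<close> does not occur in \<open>h\<close>, being reducible, nor in the part below \<open>w\<close>; hence the
  multiple with leading monomial \<open>w\<close> has coefficient \<open>0\<close>, and the bound \<open>w\<close> can be lowered.
\<close>

lemma independent_within:
  "h \<in> ideal_within {v. (v, w) \<in> r} \<Longrightarrow> Poly_Mapping.keys h \<subseteq> Irr r S \<Longrightarrow> h = 0"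
proof (induction w arbitrary: h rule: wf_induct_rule[OF wf_less])
  case (1 w)
  have "h \<in> ideal_within (below w)"
    using ideal_within_le_cases[OF 1(2)]
  proof
    assume "\<exists>\<phi>\<in>contexts. \<exists>s\<in>S. \<exists>c. \<phi> (lm s) = w \<and> h - smul c (linext \<phi> s) \<in> ideal_within (below w)"
    then obtain \<phi> s c where s: "\<phi> \<in> contexts" "s \<in> S" "\<phi> (lm s) = w"
      "h - smul c (linext \<phi> s) \<in> ideal_within (below w)"
      by blast
    have "w \<notin> Irr r S" using s by (auto simp: Irr_iff)
    then have "w \<notin> Poly_Mapping.keys h" using 1(3) by blast
    then have "Poly_Mapping.lookup (h - smul c (linext \<phi> s)) w = - c"
      using lookup_linext_lm[OF s(1,2)] s(3) by (simp add: in_keys_iff lookup_minus lookup_smul)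
    moreover have "w \<notin> Poly_Mapping.keys (h - smul c (linext \<phi> s))"
      using keys_ideal_within_below[OF s(4)] less_irrefl by blast
    ultimately have "c = 0" by (simp add: in_keys_iff)
    then show ?thesis using s(4) by simp
  qed
  then consider "h = 0" | w' where "w' \<prec> w" "h \<in> ideal_within {v. (v, w') \<in> r}"
    using ideal_within_bounded by blast
  then show ?case using 1 by cases auto
qed

lemma independent_if_compositions_trivial: irr_independent
  unfolding irr_independent_def using ideal_within_bounded independent_within by blast

end

end

section \<open>The equivalences\<close>

theorem theorem2p41:
  fixes r :: "'x bword rel"
    and S :: "('x, 'k::idom) bpoly set"
  assumes "monomial_order r"
    and "monic_set r S"
  shows "(convergent_rules (rewrite_rules r S) \<longleftrightarrow> confluent (rewrite_rules r S)) \<and>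
    (confluent (rewrite_rules r S) \<longleftrightarrow> operated_Id S \<inter> kspan (Irr r S) = {0}) \<and>
    (operated_Id S \<inter> kspan (Irr r S) = {0} \<longleftrightarrow>
      direct_sum_whole (operated_Id S) (kspan (Irr r S))) \<and>
    (direct_sum_whole (operated_Id S) (kspan (Irr r S)) \<longleftrightarrow> groebner_shirshov_basis r S)"
proof -
  interpret monic_system r S by unfold_locales fact+
  have "convergent_rules (rewrite_rules r S) \<longleftrightarrow> confluent (rewrite_rules r S)"
    using terminating by (simp add: convergent_rules_def)
  moreover have "irr_independent \<longleftrightarrow> groebner_shirshov_basis r S"
    using groebner_shirshov_basis_iff compositions_trivial_if_independent
      independent_if_compositions_trivial by blast
  ultimately show ?thesis
    using confluent_iff irr_independent_iff direct_sum_whole_iff by simp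
qed

end
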